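(* Let $X$ be a real or complex Banach space, let $1<p<\infty$, and let $(x_i)\in S(\ell^p(X))$. Then the state space $S_{(x_i)}\subseteq \ell^p(X)^*$ is weakly compact if and only if for each $i\in\mathbb{N}$ with $x_i\neq0$ the state space $S_{\frac{x_i}{\|x_i\|}}\subseteq X^*$ is weakly compact.
   Context: For a Banach space $E$, $S(E)$ is its unit sphere. For $x\in S(E)$ the state space of $x$ is $S_x=\{x^*\in S(E^* ): x^*(x)=1\}$; weak compactness of $S_x$ refers to the weak topology of $E^*$ (induced by $E^{**}$). $\ell^p(X)=\{(x_i)_{i\in\mathbb{N}}: x_i\in X,\ \sum_i\|x_i\|^p<\infty\}$ with norm $\|(x_i)\|=(\sum_i\|x_i\|^p)^{1/p}$; its dual is identified with $\ell^q(X^* )$, $\frac1p+\frac1q=1$, via $(x_i^* )((x_i))=\sum_i x_i^*(x_i)$. *)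

theory Defs
  imports "HOL-Analysis.Analysis" "HOL-Library.Function_Algebras"
begin

text \<open>
  The dual and bidual of \<open>\<ell>\<^sup>p(X)\<close> are needed, and \<open>p\<close> is a variable, so normed spaces are given by
  an explicit carrier, norm and scalar multiplication. Addition is always that of the ambient type;
  on function types it is the pointwise one of \<^theory>\<open>HOL-Library.Function_Algebras\<close>.
\<close>

record ('k, 'v) nspace =
  carrier :: "'v set"
  nrm :: "'v \<Rightarrow> real"
  scl :: "'k \<Rightarrow> 'v \<Rightarrow> 'v"

text \<open>
  A Banach space over \<open>'k\<close> (used for \<open>real\<close> and \<open>complex\<close>) is a type of class \<^class>\<open>banach\<close> with a
  scalar multiplication by \<open>'k\<close> that extends the real one and is compatible with the norm.
  For \<open>'k = real\<close> the only possibility is \<^const>\<open>scaleR\<close>.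
\<close>

definition banach_scaling :: "('k::real_normed_field \<Rightarrow> 'a::banach \<Rightarrow> 'a) \<Rightarrow> bool" where
  "banach_scaling s \<longleftrightarrow>
     vector_space s \<and>
     (\<forall>r x. s (of_real r) x = r *\<^sub>R x) \<and>
     (\<forall>c x. norm (s c x) = norm c * norm x)"

definition whole_space :: "('k::real_normed_field \<Rightarrow> 'a::banach \<Rightarrow> 'a) \<Rightarrow> ('k, 'a) nspace" where
  "whole_space s = \<lparr>carrier = UNIV, nrm = norm, scl = s\<rparr>"

definition unit_sphere :: "('k, 'v) nspace \<Rightarrow> 'v set" where
  "unit_sphere E = {x \<in> carrier E. nrm E x = 1}"

definition lp_space :: "real \<Rightarrow> ('k, 'v) nspace \<Rightarrow> ('k, nat \<Rightarrow> 'v) nspace" where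
  "lp_space p E =
     \<lparr>carrier = {x. (\<forall>i. x i \<in> carrier E) \<and> summable (\<lambda>i. nrm E (x i) powr p)},
      nrm = (\<lambda>x. (\<Sum>i. nrm E (x i) powr p) powr (1 / p)),
      scl = (\<lambda>c x i. scl E c (x i))\<rparr>"

text \<open>
  Functionals are total functions, required to vanish off the carrier so that each functional
  on the carrier has exactly one representative.
\<close>

definition dual :: "('k::real_normed_field, 'v::ab_group_add) nspace \<Rightarrow> ('k, 'v \<Rightarrow> 'k) nspace" where
  "dual E =
     \<lparr>carrier = {f. (\<forall>x\<in>carrier E. \<forall>y\<in>carrier E. f (x + y) = f x + f y) \<and>
                    (\<forall>c. \<forall>x\<in>carrier E. f (scl E c x) = c * f x) \<and>
                    (\<exists>K. \<forall>x\<in>carrier E. norm (f x) \<le> K * nrm E x) \<and>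
                    (\<forall>x. x \<notin> carrier E \<longrightarrow> f x = 0)},
      nrm = (\<lambda>f. SUP x\<in>{x \<in> carrier E. nrm E x \<le> 1}. norm (f x)),
      scl = (\<lambda>c f x. c * f x)\<rparr>"

definition weak_topology :: "('k::real_normed_field, 'v::ab_group_add) nspace \<Rightarrow> 'v topology" where
  "weak_topology E =
     topology_generated_by {{x \<in> carrier E. f x \<in> U} | f U. f \<in> carrier (dual E) \<and> open U}"

definition weakly_compact :: "('k::real_normed_field, 'v::ab_group_add) nspace \<Rightarrow> 'v set \<Rightarrow> bool" where
  "weakly_compact E A \<longleftrightarrow> compactin (weak_topology E) A"

definition state_space :: "('k::real_normed_field, 'v::ab_group_add) nspace \<Rightarrow> 'v \<Rightarrow> ('v \<Rightarrow> 'k) set" where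
  "state_space E x = {f \<in> unit_sphere (dual E). f x = 1}"

end

theory Submission
  imports Defs
begin

text \<open>
  Write \<open>E\<close> for \<open>\<ell>\<^sup>p(X)\<close>. The state space of \<open>x\<close> in the dual of \<open>E\<close> is a product, and its weak topology
  is the product of the weak topologies of the factors; the equivalence is then Tychonoff's theorem.

  The \<open>i\<close>-th factor, called \<open>face i\<close>, consists of the functionals \<open>h\<close> on \<open>X\<close> whose norm is at most
  \<open>norm (x i) powr (p - 1)\<close> and which satisfy \<open>h (x i) = norm (x i) powr p\<close>. For \<open>x i = 0\<close> it is \<open>{0}\<close>;
  otherwise it is a multiple of the state space of \<open>x i / norm (x i)\<close> (\<open>face_eq_scl\<close>). That the
  coordinates of a state lie in the faces is the equality case of Hoelder's inequality, but it is obtained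
  without identifying the dual of \<open>E\<close> with \<open>\<ell>\<^sup>q\<close>: differentiate the norm of \<open>E\<close> at \<open>x\<close> in the direction
  of one coordinate (\<open>norm_coord_le\<close>, \<open>coord_in_face\<close>).
  Conversely, any choice of elements of the faces sums to a state (\<open>combine_in_S\<close>).

  The coordinate maps are bounded and linear, hence weakly continuous. Each face is the image of the
  whole state space under its coordinate map, provided that the other faces are nonempty; this is where
  the Hahn-Banach theorem enters, in the form that every vector has a norming functional. So weak
  compactness of the state space passes to the faces. In the other direction, the product of the
  faces is compact if all the faces are, and summation maps it onto the state space. Summation is
  weakly continuous on the product of the faces (\<open>continuous_map_combine\<close>) because the partial sums
  converge in norm uniformly there: the remainders are bounded by a power of the norm of the tail of
  \<open>x\<close> (\<open>nrm_combine_drop_coords_le\<close>).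

  The argument is uniform in the scalars; only the norming functionals are constructed separately
  over the reals and over the complex numbers.
\<close>


section \<open>Norming functionals\<close>

definition sublinear :: "('a::real_vector \<Rightarrow> real) \<Rightarrow> bool" where
  "sublinear q \<longleftrightarrow> (\<forall>v w. q (v + w) \<le> q v + q w) \<and> (\<forall>c\<ge>0. \<forall>v. q (c *\<^sub>R v) = c * q v)"

lemma sublinearI:
  assumes add: "\<And>v w. q (v + w) \<le> q v + q w"
    and scale: "\<And>c v. 0 < c \<Longrightarrow> q (c *\<^sub>R v) \<le> c * q v"
    and zero: "q 0 = 0"
  shows "sublinear q"
  unfolding sublinear_def
proof (intro conjI allI impI)
  fix c :: real and v
  assume "0 \<le> c"
  show "q (c *\<^sub>R v) = c * q v"
  proof (cases "c = 0")
    case False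
    with \<open>0 \<le> c\<close> have c: "0 < c" by simp
    have "q v = q ((1 / c) *\<^sub>R (c *\<^sub>R v))"
      using c by simp
    also have "\<dots> \<le> (1 / c) * q (c *\<^sub>R v)"
      using scale[of "1 / c" "c *\<^sub>R v"] c by simp
    finally have "c * q v \<le> q (c *\<^sub>R v)"
      using c by (simp add: field_simps)
    with scale[OF c] show ?thesis
      by (simp add: antisym)
  qed (simp add: zero)
qed (rule add)

lemma
  assumes "sublinear q"
  shows sublinear_add: "q (v + w) \<le> q v + q w"
    and sublinear_scale: "0 \<le> c \<Longrightarrow> q (c *\<^sub>R v) = c * q v"
    and sublinear_zero: "q 0 = 0"
    and sublinear_minus: "- q (- v) \<le> q v"
proof -
  show add: "q (v + w) \<le> q v + q w" for v w
    using assms by (simp add: sublinear_def)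
  show scale: "0 \<le> c \<Longrightarrow> q (c *\<^sub>R v) = c * q v" for c v
    using assms by (simp add: sublinear_def)
  show zero: "q 0 = 0"
    using scale[of 0 0] by simp
  show "- q (- v) \<le> q v"
    using add[of v "- v"] zero by simp
qed

text \<open>
  A sublinear functional below \<open>q\<close> whose value at \<open>- x\<close> is as small as possible, namely \<open>- q x\<close>.
  A functional that is minimal among the sublinear ones equals all of its shifts, hence is linear.
\<close>

definition shift :: "('a::real_vector \<Rightarrow> real) \<Rightarrow> 'a \<Rightarrow> 'a \<Rightarrow> real" where
  "shift q x v = (INF t\<in>{0..}. q (v + t *\<^sub>R x) - t * q x)"

context
  fixes q :: "'a::real_vector \<Rightarrow> real" and x :: 'a
  assumes q: "sublinear q"
begin

lemma shift_le:
  assumes "0 \<le> t"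
  shows "shift q x v \<le> q (v + t *\<^sub>R x) - t * q x"
  unfolding shift_def
proof (rule cINF_lower)
  have "- q (- v) \<le> q (v + t *\<^sub>R x) - t * q x" if "0 \<le> t" for t
    using sublinear_add[OF q, of "v + t *\<^sub>R x" "- v"] sublinear_scale[OF q that, of x] by simp
  then show "bdd_below ((\<lambda>t. q (v + t *\<^sub>R x) - t * q x) ` {0..})"
    by (auto intro!: bdd_belowI2[where m = "- q (- v)"])
qed (use assms in simp)

lemma shift_greatest: "(\<And>t. 0 \<le> t \<Longrightarrow> m \<le> q (v + t *\<^sub>R x) - t * q x) \<Longrightarrow> m \<le> shift q x v"
  unfolding shift_def by (rule cINF_greatest) auto

lemma sublinear_shift: "sublinear (shift q x)"
proof (rule sublinearI)
  fix v w
  have "shift q x (v + w) - (q (w + t *\<^sub>R x) - t * q x) \<le> shift q x v" if t: "0 \<le> t" for t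
  proof (rule shift_greatest)
    fix s :: real assume s: "0 \<le> s"
    have "shift q x (v + w) \<le> q ((v + s *\<^sub>R x) + (w + t *\<^sub>R x)) - (s + t) * q x"
      using shift_le[of "s + t" "v + w"] s t by (simp add: algebra_simps)
    also have "\<dots> \<le> q (v + s *\<^sub>R x) + q (w + t *\<^sub>R x) - (s + t) * q x"
      using sublinear_add[OF q] by simp
    finally show "shift q x (v + w) - (q (w + t *\<^sub>R x) - t * q x) \<le> q (v + s *\<^sub>R x) - s * q x"
      by (simp add: algebra_simps)
  qed
  then have "shift q x (v + w) - shift q x v \<le> q (w + t *\<^sub>R x) - t * q x" if "0 \<le> t" for t
    using that by (simp add: algebra_simps)
  then have "shift q x (v + w) - shift q x v \<le> shift q x w"
    by (rule shift_greatest)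
  then show "shift q x (v + w) \<le> shift q x v + shift q x w"
    by simp
next
  fix c :: real and v
  assume c: "0 < c"
  have "shift q x (c *\<^sub>R v) / c \<le> shift q x v"
  proof (rule shift_greatest)
    fix t :: real assume t: "0 \<le> t"
    have "shift q x (c *\<^sub>R v) \<le> q (c *\<^sub>R (v + t *\<^sub>R x)) - c * t * q x"
      using shift_le[of "c * t" "c *\<^sub>R v"] c t by (simp add: algebra_simps)
    also have "\<dots> = c * (q (v + t *\<^sub>R x) - t * q x)"
      using sublinear_scale[OF q, of c "v + t *\<^sub>R x"] c
      by (simp add: right_diff_distrib del: scaleR_add_right)
    finally show "shift q x (c *\<^sub>R v) / c \<le> q (v + t *\<^sub>R x) - t * q x"
      using c by (simp add: field_simps)
  qed
  then show "shift q x (c *\<^sub>R v) \<le> c * shift q x v"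
    using c by (simp add: field_simps)
next
  show "shift q x 0 = 0"
  proof (rule antisym)
    show "shift q x 0 \<le> 0"
      using shift_le[of 0 0] sublinear_zero[OF q] by simp
    show "0 \<le> shift q x 0"
      by (rule shift_greatest) (use sublinear_scale[OF q] in simp)
  qed
qed

end

text \<open>
  Zorn's lemma provides a minimal sublinear functional below \<open>q\<close>. The lower bound of a chain is
  the pointwise infimum, which is subadditive because one of any two members lies below both.
\<close>

lemma linear_below_sublinear:
  fixes q :: "'a::real_vector \<Rightarrow> real"
  assumes q: "sublinear q"
  obtains f where "linear f" "f \<le> q"
proof -
  define A where "A = {r. sublinear r \<and> r \<le> q}"
  define P :: "('a \<Rightarrow> real) \<Rightarrow> ('a \<Rightarrow> real) \<Rightarrow> bool" where "P = (\<lambda>a b. b \<le> a)"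
  have "\<exists>m\<in>A. \<forall>a\<in>A. P m a \<longrightarrow> a = m"
  proof (rule predicate_Zorn)
    show "partial_order_on A (relation_of P A)"
      by (auto simp: P_def partial_order_on_def preorder_on_def refl_on_def trans_def antisym_def
          relation_of_def)
  next
    fix C assume C: "C \<in> Chains (relation_of P A)"
    show "\<exists>u\<in>A. \<forall>a\<in>C. P a u"
    proof (cases "C = {}")
      case True
      then show ?thesis using q by (auto simp: A_def)
    next
      case False
      have CA: "sublinear r" "r \<le> q" if "r \<in> C" for r
        using C that by (auto simp: Chains_def relation_of_def A_def)
      have total: "r \<le> r' \<or> r' \<le> r" if "r \<in> C" "r' \<in> C" for r r'
        using C that by (auto simp: Chains_def relation_of_def P_def)
      define u where "u = (\<lambda>v. INF r\<in>C. r v)"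
      have "- q (- v) \<le> r v" if "r \<in> C" for r v
        using sublinear_minus[OF CA(1)[OF that], of v] le_funD[OF CA(2)[OF that], of "- v"] by simp
      then have bdd: "bdd_below ((\<lambda>r. r v) ` C)" for v
        by (auto intro!: bdd_belowI2[where m = "- q (- v)"])
      have lower: "u v \<le> r v" if "r \<in> C" for r v
        unfolding u_def by (rule cINF_lower[OF bdd that])
      have greatest: "m \<le> u v" if "\<And>r. r \<in> C \<Longrightarrow> m \<le> r v" for m v
        unfolding u_def using False that by (rule cINF_greatest)
      have "sublinear u"
      proof (rule sublinearI)
        fix v w
        have "u (v + w) \<le> r v + r' w" if r: "r \<in> C" and r': "r' \<in> C" for r r'
        proof -
          obtain s where s: "s \<in> C" "s \<le> r" "s \<le> r'"
            using total[OF r r'] r r' by blast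
          have "u (v + w) \<le> s v + s w"
            using lower[OF s(1)] sublinear_add[OF CA(1)[OF s(1)]] order_trans by blast
          also have "\<dots> \<le> r v + r' w"
            using s by (simp add: le_fun_def add_mono)
          finally show ?thesis .
        qed
        then have "u (v + w) - r' w \<le> u v" if "r' \<in> C" for r'
          using that by (intro greatest) (simp add: algebra_simps)
        then have "u (v + w) - u v \<le> u w"
          by (intro greatest) (simp add: algebra_simps)
        then show "u (v + w) \<le> u v + u w" by simp
      next
        fix c :: real and v assume c: "0 < c"
        have "u (c *\<^sub>R v) / c \<le> u v"
        proof (rule greatest)
          fix r assume r: "r \<in> C"
          show "u (c *\<^sub>R v) / c \<le> r v"
            using lower[OF r, of "c *\<^sub>R v"] sublinear_scale[OF CA(1)[OF r], of c v] c
            by (simp add: field_simps)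
        qed
        then show "u (c *\<^sub>R v) \<le> c * u v"
          using c by (simp add: field_simps)
      next
        obtain r where "r \<in> C" using False by blast
        then show "u 0 = 0"
          using lower[of r 0] greatest[of 0 0] sublinear_zero[OF CA(1)] by force
      qed
      moreover have "u \<le> q"
        using False lower CA(2) by (metis all_not_in_conv le_funI le_funD order_trans)
      ultimately show ?thesis
        using lower by (auto simp: A_def P_def le_fun_def)
    qed
  qed
  then obtain m where m: "sublinear m" "m \<le> q" and min: "\<And>r. sublinear r \<Longrightarrow> r \<le> m \<Longrightarrow> r = m"
    unfolding A_def P_def using order_trans by blast
  have shift: "shift m x = m" for x
  proof (rule min[OF sublinear_shift[OF m(1)]])
    show "shift m x \<le> m"
      using shift_le[OF m(1), of 0] by (simp add: le_fun_def)
  qed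
  have add: "m (v + x) = m v + m x" for v x
    using shift_le[OF m(1), of 1 x v] sublinear_add[OF m(1), of v x] by (simp add: shift)
  have minus: "m (- v) = - m v" for v
    using add[of v "- v"] sublinear_zero[OF m(1)] by simp
  have "m (c *\<^sub>R v) = c * m v" for c v
  proof (cases "0 \<le> c")
    case True
    then show ?thesis by (rule sublinear_scale[OF m(1)])
  next
    case False
    then have "m ((- c) *\<^sub>R v) = (- c) * m v"
      by (intro sublinear_scale[OF m(1)]) simp
    then show ?thesis
      using minus[of "c *\<^sub>R v"] by simp
  qed
  with add have "linear m"
    by (intro linearI) simp_all
  then show ?thesis using m(2) by (rule that)
qed

text \<open>
  Below the shift of the norm in the direction \<open>x\<close>, the value at \<open>- x\<close> is at most \<open>- norm x\<close>.
\<close>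

lemma real_norming_functional:
  fixes x :: "'a::real_normed_vector"
  obtains f :: "'a \<Rightarrow> real" where "linear f" "\<And>v. \<bar>f v\<bar> \<le> norm v" "f x = norm x"
proof -
  have n: "sublinear (norm :: 'a \<Rightarrow> real)"
    by (rule sublinearI) (auto intro: norm_triangle_ineq)
  obtain f where f: "linear f" "f \<le> shift norm x"
    using linear_below_sublinear[OF sublinear_shift[OF n]] .
  have le: "f v \<le> norm v" for v
    using le_funD[OF f(2), of v] shift_le[OF n, of 0 x v] by simp
  have neg: "f (- v) = - f v" for v
    using f(1) by (rule linear_neg)
  have "\<bar>f v\<bar> \<le> norm v" for v
    using le[of v] le[of "- v"] neg[of v] by simp
  moreover have "f x = norm x"
    using le_funD[OF f(2), of "- x"] shift_le[OF n, of 1 x "- x"] le[of x] neg[of x] by simp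
  ultimately show ?thesis
    using f(1) that by blast
qed

lemma complex_norming_functional:
  fixes s :: "complex \<Rightarrow> 'a::banach \<Rightarrow> 'a"
  assumes s: "banach_scaling s"
  obtains f :: "'a \<Rightarrow> complex" where "\<And>v w. f (v + w) = f v + f w" "\<And>c v. f (s c v) = c * f v"
    "\<And>v. norm (f v) \<le> norm v" "f x = of_real (norm x)"
proof -
  interpret vector_space s
    using s by (simp add: banach_scaling_def)
  have real: "s (of_real r) v = r *\<^sub>R v" and norm_s: "norm (s c v) = norm c * norm v" for r c v
    using s by (auto simp: banach_scaling_def)
  obtain g :: "'a \<Rightarrow> real" where g: "linear g" "\<And>v. \<bar>g v\<bar> \<le> norm v" "g x = norm x"
    using real_norming_functional[of x] by blast
  have gadd: "g (v + w) = g v + g w" and gscale: "g (r *\<^sub>R v) = r * g v" for v w r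
    using g(1) by (simp_all add: linear_add linear_cmul)
  define f where "f v = Complex (g v) (- g (s \<i> v))" for v
  have s_eq: "s c v = Re c *\<^sub>R v + Im c *\<^sub>R s \<i> v" for c v
  proof -
    have "s c v = s (of_real (Re c) + of_real (Im c) * \<i>) v"
      by (simp add: complex_eq mult.commute)
    also have "\<dots> = s (of_real (Re c)) v + s (of_real (Im c)) (s \<i> v)"
      by (simp only: scale_left_distrib scale_scale)
    finally show ?thesis by (simp only: real)
  qed
  have "f (v + w) = f v + f w" for v w
    by (simp add: f_def scale_right_distrib gadd complex_eq_iff)
  moreover have fscale: "f (s c v) = c * f v" for c v
  proof -
    have "s \<i> (s c v) = s c (s \<i> v)"
      by (rule scale_left_commute)
    also have "\<dots> = Re c *\<^sub>R s \<i> v - Im c *\<^sub>R v"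
      using s_eq[of c "s \<i> v"] s_eq[of "- 1" v] by simp
    finally have "g (s \<i> (s c v)) = Re c * g (s \<i> v) - Im c * g v"
      by (simp only: linear_diff[OF g(1)] gscale)
    moreover have "g (s c v) = Re c * g v + Im c * g (s \<i> v)"
      by (simp only: s_eq[of c v] gadd gscale)
    ultimately show ?thesis
      by (simp add: f_def complex_eq_iff)
  qed
  moreover have bound: "norm (f v) \<le> norm v" for v
  proof (cases "f v = 0")
    case False
    \<comment> \<open>Rotate \<open>v\<close> so that \<open>f v\<close> becomes real, where it agrees with \<open>g\<close>.\<close>
    define c where "c = of_real (norm (f v)) / f v"
    have "norm c = 1"
      using False by (simp add: c_def norm_divide)
    have "f (s c v) = of_real (norm (f v))"
      using False by (simp add: fscale c_def)
    then have "norm (f v) = g (s c v)"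
      by (simp add: f_def complex_eq_iff)
    also have "\<dots> \<le> norm (s c v)"
      using g(2)[of "s c v"] by simp
    finally show ?thesis
      using \<open>norm c = 1\<close> by (simp add: norm_s)
  qed simp
  moreover have "f x = of_real (norm x)"
  proof -
    have "(norm x)\<^sup>2 + (g (s \<i> x))\<^sup>2 \<le> (norm x)\<^sup>2"
      using power_mono[OF bound[of x], of 2] by (simp add: f_def cmod_power2 g(3))
    then have "g (s \<i> x) = 0" by simp
    then show ?thesis
      by (simp add: f_def g(3) complex_eq_iff)
  qed
  ultimately show ?thesis by (rule that)
qed

section \<open>Duals and weak topologies\<close>

lemma in_dual_iff:
  "f \<in> carrier (dual N) \<longleftrightarrow>
     (\<forall>x\<in>carrier N. \<forall>y\<in>carrier N. f (x + y) = f x + f y) \<and>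
     (\<forall>c. \<forall>x\<in>carrier N. f (scl N c x) = c * f x) \<and>
     (\<exists>K. \<forall>x\<in>carrier N. norm (f x) \<le> K * nrm N x) \<and>
     (\<forall>x. x \<notin> carrier N \<longrightarrow> f x = 0)"
  by (simp add: dual_def)

lemma nrm_dual: "nrm (dual N) f = (SUP x\<in>{x \<in> carrier N. nrm N x \<le> 1}. norm (f x))"
  by (simp add: dual_def)

lemma scl_dual: "scl (dual N) c f = (\<lambda>x. c * f x)"
  by (simp add: dual_def)

lemma
  assumes "f \<in> carrier (dual N)"
  shows dual_add: "x \<in> carrier N \<Longrightarrow> y \<in> carrier N \<Longrightarrow> f (x + y) = f x + f y"
    and dual_scl: "x \<in> carrier N \<Longrightarrow> f (scl N c x) = c * f x"
    and dual_outside: "x \<notin> carrier N \<Longrightarrow> f x = 0"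
    and dual_bounded: "\<exists>K. \<forall>x\<in>carrier N. norm (f x) \<le> K * nrm N x"
  using assms by (simp_all add: in_dual_iff)

lemma zero_in_dual: "0 \<in> carrier (dual N)"
  by (auto simp: in_dual_iff intro!: exI[of _ 0])

lemma add_in_dual:
  assumes "f \<in> carrier (dual N)" "g \<in> carrier (dual N)"
  shows "f + g \<in> carrier (dual N)"
proof -
  obtain K L where "\<forall>x\<in>carrier N. norm (f x) \<le> K * nrm N x" "\<forall>x\<in>carrier N. norm (g x) \<le> L * nrm N x"
    using assms by (auto simp: in_dual_iff)
  then have "\<forall>x\<in>carrier N. norm ((f + g) x) \<le> (K + L) * nrm N x"
    by (auto simp: distrib_right intro!: order_trans[OF norm_triangle_ineq] add_mono)
  then have "\<exists>K. \<forall>x\<in>carrier N. norm ((f + g) x) \<le> K * nrm N x"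
    by blast
  with assms show ?thesis
    unfolding in_dual_iff by (auto simp: algebra_simps)
qed

lemma scl_in_dual:
  assumes "f \<in> carrier (dual N)"
  shows "scl (dual N) c f \<in> carrier (dual N)"
proof -
  obtain K where "\<forall>x\<in>carrier N. norm (f x) \<le> K * nrm N x"
    using assms by (auto simp: in_dual_iff)
  then have "\<forall>x\<in>carrier N. norm (c * f x) \<le> (norm c * K) * nrm N x"
    by (auto simp: norm_mult mult.assoc intro!: mult_left_mono)
  then have "\<exists>K. \<forall>x\<in>carrier N. norm (c * f x) \<le> K * nrm N x"
    by blast
  with assms show ?thesis
    unfolding in_dual_iff scl_dual by (auto simp: algebra_simps)
qed

lemma topspace_weak_topology: "topspace (weak_topology N) = carrier N"
proof -
  have "{x \<in> carrier N. (0 :: 'a \<Rightarrow> 'b) x \<in> UNIV}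
      \<in> {{x \<in> carrier N. f x \<in> U} |f U. f \<in> carrier (dual N) \<and> open U}"
    using zero_in_dual open_UNIV by blast
  then show ?thesis
    unfolding weak_topology_def topology_generated_by_topspace by auto
qed

lemma continuous_map_functional:
  assumes "f \<in> carrier (dual N)"
  shows "continuous_map (weak_topology N) euclidean f"
  unfolding continuous_map_def
proof (intro conjI allI impI)
  fix U :: "'b set" assume "openin euclidean U"
  then show "openin (weak_topology N) {x \<in> topspace (weak_topology N). f x \<in> U}"
    using assms unfolding topspace_weak_topology unfolding weak_topology_def
    by (intro topology_generated_by_Basis) auto
qed simp

lemma continuous_map_into_weak_topology:
  assumes "\<And>f. f \<in> carrier (dual N) \<Longrightarrow> continuous_map T euclidean (\<lambda>x. f (g x))"
    and range: "g ` topspace T \<subseteq> carrier N"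
  shows "continuous_map T (weak_topology N) g"
  unfolding weak_topology_def
proof (rule continuous_on_generated_topo)
  fix V assume "V \<in> {{x \<in> carrier N. f x \<in> U} |f U. f \<in> carrier (dual N) \<and> open U}"
  then obtain f U where V: "V = {x \<in> carrier N. f x \<in> U}" "f \<in> carrier (dual N)" "open U"
    by blast
  have "g -` V \<inter> topspace T = {x \<in> topspace T. f (g x) \<in> U}"
    using range by (auto simp: V(1))
  then show "openin T (g -` V \<inter> topspace T)"
    using assms(1)[OF V(2)] V(3) by (simp add: continuous_map_def)
next
  show "g ` topspace T \<subseteq> \<Union> {{x \<in> carrier N. f x \<in> U} |f U. f \<in> carrier (dual N) \<and> open U}"
    using range topspace_weak_topology[of N] unfolding weak_topology_def by simp
qed

text \<open>
  Functionals vanish outside the carrier by convention, so the composition with \<open>T\<close> has to be cut off.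
\<close>

lemma pullback_in_bidual:
  assumes F: "F \<in> carrier (dual (dual M))"
    and T: "\<And>f. f \<in> carrier (dual N) \<Longrightarrow> T f \<in> carrier (dual M)"
    and add: "\<And>f g. f \<in> carrier (dual N) \<Longrightarrow> g \<in> carrier (dual N) \<Longrightarrow> T (f + g) = T f + T g"
    and scale: "\<And>c f. f \<in> carrier (dual N) \<Longrightarrow> T (scl (dual N) c f) = scl (dual M) c (T f)"
    and bound: "\<And>f. f \<in> carrier (dual N) \<Longrightarrow> nrm (dual M) (T f) \<le> B * nrm (dual N) f"
    and nonneg: "\<And>f. f \<in> carrier (dual M) \<Longrightarrow> 0 \<le> nrm (dual M) f"
  shows "(\<lambda>f. if f \<in> carrier (dual N) then F (T f) else 0) \<in> carrier (dual (dual N))"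
proof -
  obtain K where K: "\<And>f. f \<in> carrier (dual M) \<Longrightarrow> norm (F f) \<le> K * nrm (dual M) f"
    using dual_bounded[OF F] by blast
  have "norm (F (T f)) \<le> (\<bar>K\<bar> * B) * nrm (dual N) f" if f: "f \<in> carrier (dual N)" for f
  proof -
    have "norm (F (T f)) \<le> \<bar>K\<bar> * nrm (dual M) (T f)"
      using K[OF T[OF f]] mult_right_mono[OF abs_ge_self[of K] nonneg[OF T[OF f]]] by linarith
    also have "\<dots> \<le> \<bar>K\<bar> * (B * nrm (dual N) f)"
      using bound[OF f] by (intro mult_left_mono) auto
    finally show ?thesis by (simp add: mult.assoc)
  qed
  then have "\<exists>L. \<forall>f\<in>carrier (dual N). norm (F (T f)) \<le> L * nrm (dual N) f"
    by blast
  then show ?thesis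
    unfolding in_dual_iff[of "\<lambda>f. if f \<in> carrier (dual N) then F (T f) else 0"]
    by (simp add: add_in_dual scl_in_dual add scale dual_add[OF F] dual_scl[OF F] T)
qed

lemma continuous_map_weak_weak:
  assumes T: "\<And>f. f \<in> carrier (dual N) \<Longrightarrow> T f \<in> carrier (dual M)"
    and add: "\<And>f g. f \<in> carrier (dual N) \<Longrightarrow> g \<in> carrier (dual N) \<Longrightarrow> T (f + g) = T f + T g"
    and scale: "\<And>c f. f \<in> carrier (dual N) \<Longrightarrow> T (scl (dual N) c f) = scl (dual M) c (T f)"
    and bound: "\<And>f. f \<in> carrier (dual N) \<Longrightarrow> nrm (dual M) (T f) \<le> B * nrm (dual N) f"
    and nonneg: "\<And>f. f \<in> carrier (dual M) \<Longrightarrow> 0 \<le> nrm (dual M) f"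
  shows "continuous_map (weak_topology (dual N)) (weak_topology (dual M)) T"
proof (rule continuous_map_into_weak_topology)
  fix F assume F: "F \<in> carrier (dual (dual M))"
  have "continuous_map (weak_topology (dual N)) euclidean
      (\<lambda>f. if f \<in> carrier (dual N) then F (T f) else 0)"
    by (rule continuous_map_functional[OF pullback_in_bidual[OF F T add scale bound nonneg]])
  then show "continuous_map (weak_topology (dual N)) euclidean (\<lambda>f. F (T f))"
    by (rule continuous_map_eq) (simp add: topspace_weak_topology)
qed (auto simp: topspace_weak_topology T)

text \<open>
  Homogeneity of the norm is what carries bounds on the unit ball over to the whole space; for
  \<open>\<ell>\<^sup>p\<close> it can be read off the formula for the norm.
\<close>

locale homogeneous_space =
  fixes N :: "('k::real_normed_field, 'v::ab_group_add) nspace"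
  assumes add_closed: "x \<in> carrier N \<Longrightarrow> y \<in> carrier N \<Longrightarrow> x + y \<in> carrier N"
    and scl_closed: "x \<in> carrier N \<Longrightarrow> scl N c x \<in> carrier N"
    and zero_closed: "0 \<in> carrier N"
    and nrm_nonneg: "x \<in> carrier N \<Longrightarrow> 0 \<le> nrm N x"
    and nrm_scl: "x \<in> carrier N \<Longrightarrow> nrm N (scl N c x) = norm c * nrm N x"
    and nrm_zero: "nrm N 0 = 0"
begin

lemma dual_zero: "f \<in> carrier (dual N) \<Longrightarrow> f 0 = 0"
  using dual_add[of f N 0 0] zero_closed by simp

lemma nrm_dual_le:
  assumes "\<And>x. x \<in> carrier N \<Longrightarrow> norm (f x) \<le> B * nrm N x" "0 \<le> B"
  shows "nrm (dual N) f \<le> B"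
  unfolding nrm_dual
proof (rule cSUP_least)
  show "{x \<in> carrier N. nrm N x \<le> 1} \<noteq> {}"
    using zero_closed nrm_zero by force
  fix x assume x: "x \<in> {x \<in> carrier N. nrm N x \<le> 1}"
  then have "norm (f x) \<le> B * nrm N x"
    using assms(1) by simp
  also have "\<dots> \<le> B"
    using x assms(2) by (intro mult_left_le) auto
  finally show "norm (f x) \<le> B" .
qed

lemma norm_le_nrm_dual:
  assumes f: "f \<in> carrier (dual N)" and x: "x \<in> carrier N" "nrm N x \<le> 1"
  shows "norm (f x) \<le> nrm (dual N) f"
  unfolding nrm_dual
proof (rule cSUP_upper)
  obtain K where K: "\<And>x. x \<in> carrier N \<Longrightarrow> norm (f x) \<le> K * nrm N x"
    using dual_bounded[OF f] by blast
  have "norm (f x) \<le> \<bar>K\<bar>" if "x \<in> carrier N" "nrm N x \<le> 1" for x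
  proof -
    have "norm (f x) \<le> \<bar>K\<bar> * nrm N x"
      using K[OF that(1)] mult_right_mono[OF abs_ge_self[of K] nrm_nonneg[OF that(1)]] by linarith
    also have "\<dots> \<le> \<bar>K\<bar>"
      using that by (intro mult_left_le) auto
    finally show ?thesis .
  qed
  then show "bdd_above ((\<lambda>x. norm (f x)) ` {x \<in> carrier N. nrm N x \<le> 1})"
    by (auto intro!: bdd_aboveI2[where M = "\<bar>K\<bar>"])
qed (use x in simp)

lemma nrm_dual_nonneg: "f \<in> carrier (dual N) \<Longrightarrow> 0 \<le> nrm (dual N) f"
  using norm_le_nrm_dual[of f 0] zero_closed nrm_zero by (simp add: dual_zero)

lemma norm_le_nrm_dual_mult:
  assumes f: "f \<in> carrier (dual N)" and x: "x \<in> carrier N"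
  shows "norm (f x) \<le> nrm (dual N) f * nrm N x"
proof (cases "nrm N x = 0")
  case True
  obtain K where "\<And>x. x \<in> carrier N \<Longrightarrow> norm (f x) \<le> K * nrm N x"
    using dual_bounded[OF f] by blast
  from this[OF x] True show ?thesis by simp
next
  case False
  then have pos: "0 < nrm N x"
    using nrm_nonneg[OF x] by simp
  let ?y = "scl N (of_real (1 / nrm N x)) x"
  have "norm (f ?y) \<le> nrm (dual N) f"
    using pos by (intro norm_le_nrm_dual[OF f] scl_closed x) (simp add: nrm_scl[OF x] norm_divide)
  then show ?thesis
    using pos by (simp add: dual_scl[OF f x] norm_mult norm_divide field_simps)
qed

lemma nrm_scl_dual_le:
  assumes "f \<in> carrier (dual N)"
  shows "nrm (dual N) (scl (dual N) c f) \<le> norm c * nrm (dual N) f"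
  using assms norm_le_nrm_dual_mult nrm_dual_nonneg
  by (intro nrm_dual_le) (auto simp: scl_dual norm_mult mult.assoc intro!: mult_left_mono)

lemma state_space_iff:
  assumes x: "x \<in> unit_sphere N"
  shows "f \<in> state_space N x \<longleftrightarrow>
    f \<in> carrier (dual N) \<and> (\<forall>y\<in>carrier N. norm (f y) \<le> nrm N y) \<and> f x = 1"
proof -
  have x': "x \<in> carrier N" "nrm N x = 1"
    using x by (simp_all add: unit_sphere_def)
  have "nrm (dual N) f = 1"
    if "f \<in> carrier (dual N)" "\<forall>y\<in>carrier N. norm (f y) \<le> nrm N y" "f x = 1"
    using that nrm_dual_le[of f 1] norm_le_nrm_dual[of f x] x' by simp
  moreover have "norm (f y) \<le> nrm N y"
    if "f \<in> carrier (dual N)" "nrm (dual N) f = 1" "y \<in> carrier N" for y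
    using norm_le_nrm_dual_mult[OF that(1,3)] that(2) by simp
  ultimately show ?thesis
    by (auto simp: state_space_def unit_sphere_def)
qed

lemma continuous_map_weak_scl:
  "continuous_map (weak_topology (dual N)) (weak_topology (dual N)) (scl (dual N) c)"
proof (rule continuous_map_weak_weak)
  fix f assume f: "f \<in> carrier (dual N)"
  show "nrm (dual N) (scl (dual N) c f) \<le> norm c * nrm (dual N) f"
    by (rule nrm_scl_dual_le[OF f])
qed (auto simp: scl_in_dual[unfolded scl_dual] nrm_dual_nonneg scl_dual fun_eq_iff algebra_simps)

end

section \<open>Real inequalities\<close>

text \<open>Young's inequality for the conjugate exponents \<open>p / (p - 1)\<close> and \<open>p\<close>.\<close>

lemma young_powr:
  fixes a b p :: real
  assumes "1 < p" "0 \<le> a" "0 \<le> b"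
  shows "p * (a powr (p - 1) * b) \<le> (p - 1) * a powr p + b powr p"
proof (cases "a = 0 \<or> b = 0")
  case True
  then show ?thesis using assms by auto
next
  case False
  then have pos: "0 < a" "0 < b" using assms by auto
  have "(a powr p) powr ((p - 1) / p) * (b powr p) powr (1 / p)
      \<le> (p - 1) / p * a powr p + 1 / p * b powr p"
    using assms pos by (intro Youngs_inequality_0) (auto simp: field_simps)
  moreover have "(a powr p) powr ((p - 1) / p) = a powr (p - 1)" "(b powr p) powr (1 / p) = b"
    using assms pos by (simp_all add: powr_powr)
  ultimately have "a powr (p - 1) * b \<le> ((p - 1) * a powr p + b powr p) / p"
    by (simp add: add_divide_distrib)
  then show ?thesis
    using assms by (simp add: pos_le_divide_eq mult.commute)
qed

text \<open>
  Both sides of the assumed inequality equal \<open>1\<close> at \<open>t = 0\<close>, so their one-sided derivatives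
  \<open>p * z\<close> and \<open>p * a powr (p - 1) * b\<close> there are ordered in the same way.
\<close>

lemma powr_perturbation:
  fixes a b p z :: real
  assumes p: "1 < p" and nonneg: "0 \<le> a" "0 \<le> b" "0 \<le> z"
    and le: "\<And>t. 0 < t \<Longrightarrow> (1 + t * z) powr p \<le> 1 - a powr p + (a + t * b) powr p"
  shows "z \<le> a powr (p - 1) * b"
proof -
  have bound: "z \<le> (a + t * b) powr (p - 1) * b" if t: "0 < t" for t
  proof -
    have "p * (t * z) \<le> (1 + t * z) powr p - 1"
      using young_powr[OF p, of 1 "1 + t * z"] t nonneg by (simp add: algebra_simps)
    also have "\<dots> \<le> (a + t * b) powr p - a powr p"
      using le[OF t] by simp
    also have "\<dots> \<le> p * ((a + t * b) powr (p - 1) * (a + t * b)) - p * ((a + t * b) powr (p - 1) * a)"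
    proof -
      have "(a + t * b) powr (p - 1) * (a + t * b) = (a + t * b) powr p"
        using t nonneg by (cases "a + t * b = 0") (auto simp: powr_diff)
      then show ?thesis
        using young_powr[OF p, of "a + t * b" a] t nonneg by (simp add: algebra_simps)
    qed
    also have "\<dots> = p * (t * ((a + t * b) powr (p - 1) * b))"
      by (simp add: algebra_simps)
    finally show ?thesis
      using p t by simp
  qed
  have "((\<lambda>t. (a + t * b) powr (p - 1) * b) \<longlongrightarrow> (a + 0 * b) powr (p - 1) * b) (at_right 0)"
    using p nonneg
    by (intro tendsto_mult tendsto_powr' tendsto_add tendsto_const tendsto_ident_at)
       (auto simp: eventually_at_right_less intro!: eventually_mono[OF eventually_at_right_less])
  then show ?thesis
    using bound by (intro tendsto_lowerbound[where F = "at_right 0"])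
      (auto intro!: eventually_mono[OF eventually_at_right_less])
qed

lemma hoelder_powr_suminf:
  fixes b y :: "nat \<Rightarrow> real"
  assumes p: "1 < p" and nonneg: "\<And>i. 0 \<le> b i" "\<And>i. 0 \<le> y i" and pos: "0 < B" "0 < Y"
    and b: "summable (\<lambda>i. b i powr p)" "(\<Sum>i. b i powr p) \<le> B powr p"
    and y: "summable (\<lambda>i. y i powr p)" "(\<Sum>i. y i powr p) \<le> Y powr p"
  shows "summable (\<lambda>i. b i powr (p - 1) * y i)"
    and "(\<Sum>i. b i powr (p - 1) * y i) \<le> B powr (p - 1) * Y"
proof -
  define c where "c = B powr (p - 1) * Y"
  have c: "0 < c" using pos by (simp add: c_def)
  define u where "u i = c / p * ((p - 1) * (b i powr p / B powr p) + y i powr p / Y powr p)" for i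
  have le: "b i powr (p - 1) * y i \<le> u i" for i
  proof -
    have "p * ((b i / B) powr (p - 1) * (y i / Y)) \<le> (p - 1) * (b i / B) powr p + (y i / Y) powr p"
      using nonneg pos by (intro young_powr[OF p]) auto
    then have "p * (b i powr (p - 1) * y i) / c
        \<le> (p - 1) * (b i powr p / B powr p) + y i powr p / Y powr p"
      using nonneg pos by (simp add: powr_divide c_def)
    then show ?thesis
      using c p by (simp add: u_def field_simps)
  qed
  have u: "u sums (c / p * ((p - 1) * ((\<Sum>i. b i powr p) / B powr p) + (\<Sum>i. y i powr p) / Y powr p))"
    unfolding u_def by (intro sums_mult sums_add sums_divide summable_sums b y)
  show s: "summable (\<lambda>i. b i powr (p - 1) * y i)"
    by (rule summable_comparison_test'[OF sums_summable[OF u], of 0]) (use le nonneg in simp)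
  have "(\<Sum>i. b i powr (p - 1) * y i)
      \<le> c / p * ((p - 1) * ((\<Sum>i. b i powr p) / B powr p) + (\<Sum>i. y i powr p) / Y powr p)"
    using suminf_le[OF le s sums_summable[OF u]] sums_unique[OF u] by simp
  also have "\<dots> \<le> c / p * ((p - 1) * 1 + 1)"
    using b(2) y(2) pos p c by (intro mult_left_mono add_mono) (auto simp: field_simps)
  also have "\<dots> = c"
    using p by simp
  finally show "(\<Sum>i. b i powr (p - 1) * y i) \<le> B powr (p - 1) * Y"
    by (simp add: c_def)
qed

text \<open>
  The triangle inequality for \<open>1 = z + (1 - z)\<close> is then an equality, which in an inner product
  space forces both summands to be nonnegative multiples of \<open>1\<close>.
\<close>

lemma eq_of_real_if_norm_le:
  fixes z :: "'k::{real_normed_field, real_inner}"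
  assumes "norm z \<le> r" "norm (1 - z) \<le> 1 - r"
  shows "z = of_real r"
proof -
  have r: "0 \<le> r" using assms(1) norm_ge_zero order_trans by blast
  have "inner 1 (1 - z) \<le> 1 - r"
    using norm_cauchy_schwarz[of 1 "1 - z"] assms(2) by simp
  then have i: "r \<le> inner 1 z"
    by (simp add: inner_diff_right dot_square_norm)
  have one: "inner 1 (1 :: 'k) = 1"
    by (simp add: dot_square_norm)
  have "(norm (z - r *\<^sub>R 1))\<^sup>2 = (norm z)\<^sup>2 - 2 * r * inner 1 z + r\<^sup>2"
    unfolding power2_norm_eq_inner
    by (simp add: inner_diff inner_commute one algebra_simps power2_eq_square)
  also have "\<dots> \<le> r\<^sup>2 - 2 * r * r + r\<^sup>2"
    using i r assms(1) by (intro add_mono diff_mono mult_left_mono power_mono) auto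
  also have "\<dots> = 0"
    by (simp add: power2_eq_square)
  finally show ?thesis
    by (simp add: of_real_def)
qed

section \<open>Functionals on sequence spaces\<close>

text \<open>
  The sort of the scalars covers the real and the complex numbers. Its inner product is there to apply
  \<open>eq_of_real_if_norm_le\<close> to values of functionals.
\<close>

locale lp_sequences =
  fixes p :: real and s :: "'k::{real_normed_field, euclidean_space} \<Rightarrow> 'a::banach \<Rightarrow> 'a"
  assumes p: "1 < p" and s: "banach_scaling s"
begin

abbreviation X :: "('k, 'a) nspace" where "X \<equiv> whole_space s"
abbreviation E :: "('k, nat \<Rightarrow> 'a) nspace" where "E \<equiv> lp_space p X"

lemma X_simps: "carrier X = UNIV" "nrm X = norm" "scl X = s"
  by (simp_all add: whole_space_def)

lemma in_E: "y \<in> carrier E \<longleftrightarrow> summable (\<lambda>i. norm (y i) powr p)"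
  by (simp add: lp_space_def X_simps)

lemma nrm_E: "nrm E y = (\<Sum>i. norm (y i) powr p) powr (1 / p)"
  by (simp add: lp_space_def X_simps)

lemma scl_E: "scl E c y = (\<lambda>i. s c (y i))"
  by (simp add: lp_space_def X_simps)

lemma norm_s: "norm (s c v) = norm c * norm v"
  using s by (simp add: banach_scaling_def)

sublocale s: vector_space s
  using s by (simp add: banach_scaling_def)

sublocale X: homogeneous_space X
  by unfold_locales (auto simp: X_simps norm_s)

lemma nrm_E_powr: "y \<in> carrier E \<Longrightarrow> nrm E y powr p = (\<Sum>i. norm (y i) powr p)"
  using p by (simp add: nrm_E powr_powr suminf_nonneg in_E)

lemma add_closed_E:
  assumes "y \<in> carrier E" "z \<in> carrier E"
  shows "y + z \<in> carrier E"
  unfolding in_E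
proof (rule summable_comparison_test')
  show "summable (\<lambda>i. 2 powr p * (norm (y i) powr p + norm (z i) powr p))"
    using assms by (intro summable_mult summable_add) (auto simp: in_E)
  fix i :: nat
  have "norm (y i + z i) powr p \<le> (2 * max (norm (y i)) (norm (z i))) powr p"
    using p norm_triangle_ineq[of "y i" "z i"] by (intro powr_mono2) auto
  also have "\<dots> \<le> 2 powr p * (norm (y i) powr p + norm (z i) powr p)"
    by (auto simp: powr_mult max_def)
  finally show "norm (norm ((y + z) i) powr p) \<le> 2 powr p * (norm (y i) powr p + norm (z i) powr p)"
    by simp
qed

sublocale E: homogeneous_space E
proof
  fix y z c assume y: "y \<in> carrier E"
  have eq: "(\<lambda>i. norm (s c (y i)) powr p) = (\<lambda>i. norm c powr p * norm (y i) powr p)"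
    by (simp add: norm_s powr_mult)
  show "scl E c y \<in> carrier E"
    using y by (simp add: in_E scl_E eq summable_mult)
  show "nrm E (scl E c y) = norm c * nrm E y"
    using y p by (simp add: nrm_E scl_E eq in_E suminf_mult powr_mult powr_powr suminf_nonneg)
  show "0 \<le> nrm E y" by (simp add: nrm_E)
qed (erule (1) add_closed_E | use p in \<open>simp add: in_E nrm_E\<close>)+

lemma coordinate_le:
  assumes "y \<in> carrier E"
  shows "norm (y i) \<le> nrm E y"
proof -
  have "norm (y i) powr p \<le> (\<Sum>j. norm (y j) powr p)"
    using assms sum_le_suminf[of "\<lambda>j. norm (y j) powr p" "{i}"] by (simp add: in_E)
  then have "(norm (y i) powr p) powr (1 / p) \<le> nrm E y"
    unfolding nrm_E using p by (intro powr_mono2) auto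
  then show ?thesis using p by (simp add: powr_powr)
qed

definition single :: "nat \<Rightarrow> 'a \<Rightarrow> nat \<Rightarrow> 'a" where
  "single i v = (\<lambda>j. if j = i then v else 0)"

definition tail :: "nat \<Rightarrow> (nat \<Rightarrow> 'a) \<Rightarrow> nat \<Rightarrow> 'a" where
  "tail n y = (\<lambda>j. if j < n then 0 else y j)"

lemma single_in_E: "single i v \<in> carrier E" and nrm_single: "nrm E (single i v) = norm v"
proof -
  have "(\<lambda>j. norm (single i v j) powr p) = (\<lambda>j. if j = i then norm v powr p else 0)"
    using p by (auto simp: single_def)
  then have *: "(\<lambda>j. norm (single i v j) powr p) sums (norm v powr p)"
    using sums_single[of i "\<lambda>_. norm v powr p"] by simp
  then show "single i v \<in> carrier E"
    unfolding in_E by (rule sums_summable)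
  show "nrm E (single i v) = norm v"
    unfolding nrm_E using p sums_unique[OF *, symmetric] by (simp add: powr_powr)
qed

lemma single_add: "single i (v + w) = single i v + single i w"
  by (auto simp: single_def)

lemma single_s: "single i (s c v) = scl E c (single i v)"
  by (auto simp: single_def scl_E)

lemma tail_step: "tail n y = single n (y n) + tail (Suc n) y"
  by (auto simp: tail_def single_def fun_eq_iff less_Suc_eq)

lemma tail_sums:
  assumes "y \<in> carrier E"
  shows "(\<lambda>j. norm (tail n y j) powr p) sums
    ((\<Sum>j. norm (y j) powr p) - (\<Sum>j<n. norm (y j) powr p))"
proof -
  have "(\<lambda>j. norm (tail n y j) powr p) =
      (\<lambda>j. norm (y j) powr p - (if j \<in> {..<n} then norm (y j) powr p else 0))"
    using p by (auto simp: tail_def)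
  then show ?thesis
    using assms sums_If_finite_set[of "{..<n}" "\<lambda>j. norm (y j) powr p"]
    by (auto simp: in_E intro!: sums_diff summable_sums)
qed

lemma tail_in_E: "y \<in> carrier E \<Longrightarrow> tail n y \<in> carrier E"
  using sums_summable[OF tail_sums] by (simp add: in_E)

lemma nrm_tail_tendsto_0:
  assumes y: "y \<in> carrier E"
  shows "(\<lambda>n. nrm E (tail n y)) \<longlonglongrightarrow> 0"
  unfolding nrm_E
proof (rule tendsto_zero_powrI)
  have "(\<lambda>n. (\<Sum>j. norm (y j) powr p) - (\<Sum>j<n. norm (y j) powr p)) \<longlonglongrightarrow>
      (\<Sum>j. norm (y j) powr p) - (\<Sum>j. norm (y j) powr p)"
    using y by (intro tendsto_diff tendsto_const summable_LIMSEQ) (simp add: in_E)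
  then show "(\<lambda>n. \<Sum>j. norm (tail n y j) powr p) \<longlonglongrightarrow> 0"
    using sums_unique[OF tail_sums[OF y]] by simp
  show "\<forall>\<^sub>F n in sequentially. 0 \<le> (\<Sum>j. norm (tail n y j) powr p)"
    using sums_summable[OF tail_sums[OF y]] by (intro always_eventually allI suminf_nonneg) auto
qed (use p in auto)

definition coord :: "nat \<Rightarrow> ((nat \<Rightarrow> 'a) \<Rightarrow> 'k) \<Rightarrow> 'a \<Rightarrow> 'k" where
  "coord i f = (\<lambda>v. f (single i v))"

definition embed :: "nat \<Rightarrow> ('a \<Rightarrow> 'k) \<Rightarrow> (nat \<Rightarrow> 'a) \<Rightarrow> 'k" where
  "embed i h = (\<lambda>y. if y \<in> carrier E then h (y i) else 0)"

definition combine :: "(nat \<Rightarrow> 'a \<Rightarrow> 'k) \<Rightarrow> (nat \<Rightarrow> 'a) \<Rightarrow> 'k" where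
  "combine h = (\<lambda>y. if y \<in> carrier E then \<Sum>i. h i (y i) else 0)"

lemma coord_sums:
  assumes f: "f \<in> carrier (dual E)" and y: "y \<in> carrier E"
  shows "(\<lambda>i. coord i f (y i)) sums f y"
proof -
  have eq: "f y = (\<Sum>i<n. coord i f (y i)) + f (tail n y)" for n
  proof (induction n)
    case 0
    then show ?case by (simp add: tail_def)
  next
    case (Suc n)
    have "f (tail n y) = coord n f (y n) + f (tail (Suc n) y)"
      unfolding coord_def
      by (subst tail_step, rule dual_add[OF f single_in_E tail_in_E[OF y]])
    with Suc show ?case by simp
  qed
  have "(\<lambda>n. f (tail n y)) \<longlonglongrightarrow> 0"
  proof (rule Lim_null_comparison)
    show "\<forall>\<^sub>F n in sequentially. norm (f (tail n y)) \<le> nrm (dual E) f * nrm E (tail n y)"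
      using E.norm_le_nrm_dual_mult[OF f tail_in_E[OF y]] by simp
    show "(\<lambda>n. nrm (dual E) f * nrm E (tail n y)) \<longlonglongrightarrow> 0"
      by (intro tendsto_mult_right_zero nrm_tail_tendsto_0 y)
  qed
  then have "(\<lambda>n. f y - f (tail n y)) \<longlonglongrightarrow> f y - 0"
    by (intro tendsto_diff tendsto_const)
  moreover have "f y - f (tail n y) = (\<Sum>i<n. coord i f (y i))" for n
    using eq[of n] by (metis add_diff_cancel_right')
  ultimately show ?thesis
    by (simp add: sums_def)
qed

lemma
  assumes "f \<in> carrier (dual E)"
  shows coord_in_dual: "coord i f \<in> carrier (dual X)"
    and nrm_coord_le: "nrm (dual X) (coord i f) \<le> nrm (dual E) f"
proof -
  have bound: "norm (coord i f v) \<le> nrm (dual E) f * norm v" for v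
    unfolding coord_def using E.norm_le_nrm_dual_mult[OF assms single_in_E] by (simp add: nrm_single)
  then have "\<exists>K. \<forall>v. norm (coord i f v) \<le> K * norm v"
    by blast
  then show "coord i f \<in> carrier (dual X)"
    unfolding in_dual_iff X_simps
    by (auto simp: coord_def single_add single_s dual_add[OF assms single_in_E single_in_E]
        dual_scl[OF assms single_in_E])
  show "nrm (dual X) (coord i f) \<le> nrm (dual E) f"
    using bound by (intro X.nrm_dual_le E.nrm_dual_nonneg assms) (simp add: X_simps)
qed

lemma
  assumes h: "h \<in> carrier (dual X)"
  shows embed_in_dual: "embed i h \<in> carrier (dual E)"
    and nrm_embed_le: "nrm (dual E) (embed i h) \<le> nrm (dual X) h"
proof -
  have bound: "norm (embed i h y) \<le> nrm (dual X) h * nrm E y" if "y \<in> carrier E" for y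
  proof -
    have "norm (h (y i)) \<le> nrm (dual X) h * norm (y i)"
      using X.norm_le_nrm_dual_mult[OF h, of "y i"] by (simp add: X_simps)
    also have "\<dots> \<le> nrm (dual X) h * nrm E y"
      by (intro mult_left_mono coordinate_le that X.nrm_dual_nonneg h)
    finally show ?thesis by (simp add: embed_def that)
  qed
  then have "\<exists>K. \<forall>y\<in>carrier E. norm (embed i h y) \<le> K * nrm E y"
    by blast
  then show "embed i h \<in> carrier (dual E)"
    unfolding in_dual_iff[of "embed i h"]
    using dual_add[OF h] dual_scl[OF h] E.add_closed E.scl_closed
    by (auto simp: embed_def X_simps scl_E)
  show "nrm (dual E) (embed i h) \<le> nrm (dual X) h"
    using bound by (intro E.nrm_dual_le X.nrm_dual_nonneg h)
qed

lemma continuous_map_coord: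
  "continuous_map (weak_topology (dual E)) (weak_topology (dual X)) (coord i)"
proof (rule continuous_map_weak_weak[where B = 1])
  show "coord i (f + g) = coord i f + coord i g" for f g
    by (simp add: coord_def fun_eq_iff)
  show "coord i (scl (dual E) c f) = scl (dual X) c (coord i f)" for c f
    by (simp add: coord_def scl_dual)
qed (simp_all add: coord_in_dual nrm_coord_le X.nrm_dual_nonneg)

text \<open>
  By Hoelder's inequality, functionals bounded by \<open>b i powr (p - 1)\<close> for an \<open>\<ell>\<^sup>p\<close> sequence \<open>b\<close> can be summed.
  That the bound on the sum is controlled by \<open>b\<close> alone is what makes tails uniformly small.
\<close>

lemma
  assumes h: "\<And>i. h i \<in> carrier (dual X)" "\<And>i v. norm (h i v) \<le> b i powr (p - 1) * norm v"
    and b: "\<And>i. 0 \<le> b i" "summable (\<lambda>i. b i powr p)" "(\<Sum>i. b i powr p) \<le> B powr p" "0 < B"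
  shows combine_sums: "y \<in> carrier E \<Longrightarrow> (\<lambda>i. h i (y i)) sums combine h y"
    and combine_in_dual: "combine h \<in> carrier (dual E)"
    and norm_combine_le: "y \<in> carrier E \<Longrightarrow> norm (combine h y) \<le> B powr (p - 1) * nrm E y"
proof -
  have *: "summable (\<lambda>i. h i (y i)) \<and> norm (\<Sum>i. h i (y i)) \<le> B powr (p - 1) * nrm E y"
    if y: "y \<in> carrier E" for y
  proof (cases "nrm E y = 0")
    case True
    then have "y i = 0" for i
      using coordinate_le[OF y, of i] by simp
    then show ?thesis
      using True X.dual_zero[OF h(1)] by simp
  next
    case False
    then have pos: "0 < nrm E y"
      using E.nrm_nonneg[OF y] by simp
    note hoelder = hoelder_powr_suminf[of p b "\<lambda>i. norm (y i)" B "nrm E y"]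
    have s: "summable (\<lambda>i. b i powr (p - 1) * norm (y i))"
      using p b pos y by (intro hoelder) (auto simp: nrm_E_powr in_E)
    have s': "summable (\<lambda>i. norm (h i (y i)))"
      by (rule summable_comparison_test'[OF s, of 0]) (simp add: h)
    have "norm (\<Sum>i. h i (y i)) \<le> (\<Sum>i. norm (h i (y i)))"
      by (rule summable_norm[OF s'])
    also have "\<dots> \<le> (\<Sum>i. b i powr (p - 1) * norm (y i))"
      by (rule suminf_le[OF h(2) s' s])
    also have "\<dots> \<le> B powr (p - 1) * nrm E y"
      using p b pos y by (intro hoelder) (auto simp: nrm_E_powr in_E)
    finally show ?thesis
      using summable_norm_cancel[OF s'] by simp
  qed
  show sums: "(\<lambda>i. h i (y i)) sums combine h y" if "y \<in> carrier E" for y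
    using * that by (simp add: combine_def summable_sums)
  show bound: "norm (combine h y) \<le> B powr (p - 1) * nrm E y" if "y \<in> carrier E" for y
    using * that by (simp add: combine_def)
  show "combine h \<in> carrier (dual E)"
    unfolding in_dual_iff
  proof (intro conjI ballI allI impI)
    fix y z assume y: "y \<in> carrier E" and z: "z \<in> carrier E"
    have "h i ((y + z) i) = h i (y i) + h i (z i)" for i
      using dual_add[OF h(1)] by (simp add: X_simps)
    then show "combine h (y + z) = combine h y + combine h z"
      using sums_unique2[OF sums[OF E.add_closed[OF y z]]] sums_add[OF sums[OF y] sums[OF z]] by simp
  next
    fix c y assume y: "y \<in> carrier E"
    have "h i (scl E c y i) = c * h i (y i)" for i
      using dual_scl[OF h(1)] by (simp add: X_simps scl_E)
    then show "combine h (scl E c y) = c * combine h y"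
      using sums_unique2[OF sums[OF E.scl_closed[OF y]]] sums_mult[OF sums[OF y]] by simp
  qed (use bound in \<open>auto simp: combine_def\<close>)
qed

end

section \<open>The state space as a product\<close>

locale lp_state = lp_sequences p s
  for p and s :: "'k::{real_normed_field, euclidean_space} \<Rightarrow> 'a::banach \<Rightarrow> 'a" +
  fixes x :: "nat \<Rightarrow> 'a"
  assumes x: "x \<in> unit_sphere E"
    and norming: "\<exists>h\<in>carrier (dual X). (\<forall>w. norm (h w) \<le> norm w) \<and> h v = of_real (norm v)"
begin

abbreviation S :: "((nat \<Rightarrow> 'a) \<Rightarrow> 'k) set" where "S \<equiv> state_space E x"

text \<open>
  The state space of the \<open>i\<close>-th unit vector \<open>x i / norm (x i)\<close>, scaled by \<open>norm (x i) powr (p - 1)\<close>;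
  without the division the definition also makes sense for \<open>x i = 0\<close>.
\<close>

definition face :: "nat \<Rightarrow> ('a \<Rightarrow> 'k) set" where
  "face i = {h \<in> carrier (dual X). (\<forall>v. norm (h v) \<le> norm (x i) powr (p - 1) * norm v) \<and>
                                   h (x i) = of_real (norm (x i) powr p)}"

lemma x_in_E: "x \<in> carrier E" and x_sums: "(\<lambda>i. norm (x i) powr p) sums 1"
proof -
  show "x \<in> carrier E"
    using x by (simp add: unit_sphere_def)
  then have "(\<lambda>i. norm (x i) powr p) sums (nrm E x powr p)"
    by (simp add: nrm_E_powr in_E summable_sums)
  then show "(\<lambda>i. norm (x i) powr p) sums 1"
    using x by (simp add: unit_sphere_def)
qed

lemmas S_iff = E.state_space_iff[OF x]

lemma powr_pred_mult_norm: "norm v powr (p - 1) * norm v = norm v powr p"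
  by (cases "v = 0") (simp_all add: powr_diff)

text \<open>
  The functional \<open>f\<close> is at most the norm and agrees with it at \<open>x\<close>. Comparing both along
  \<open>x + t * v\<close> with \<open>v\<close> in the \<open>i\<close>-th coordinate bounds \<open>f v\<close> by the derivative of the norm.
\<close>

lemma norm_coord_le:
  assumes f: "f \<in> S"
  shows "norm (coord i f v) \<le> norm (x i) powr (p - 1) * norm v"
proof (cases "coord i f v = 0")
  case False
  have f': "f \<in> carrier (dual E)" "\<And>y. y \<in> carrier E \<Longrightarrow> norm (f y) \<le> nrm E y" "f x = 1"
    using f by (auto simp: S_iff)
  define z where "z = norm (coord i f v)"
  define c where "c = of_real z / coord i f v"
  have c: "norm c = 1" "c * coord i f v = of_real z"
    using False by (simp_all add: c_def z_def norm_divide)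
  show ?thesis
  proof (fold z_def, rule powr_perturbation[OF p])
    fix t :: real assume t: "0 < t"
    define w where "w = s (of_real t * c) v"
    have w: "norm w = t * norm v"
      using t c by (simp add: w_def norm_s norm_mult)
    define y where "y = x + single i w"
    have y: "y \<in> carrier E"
      unfolding y_def by (intro E.add_closed x_in_E single_in_E)
    define g where "g j = norm (x j) powr p +
      (if j = i then (norm (x i) + t * norm v) powr p - norm (x i) powr p else 0)" for j
    have g: "g sums (1 + ((norm (x i) + t * norm v) powr p - norm (x i) powr p))"
      unfolding g_def by (intro sums_add x_sums sums_single)
    have le: "norm (y j) powr p \<le> g j" for j
      using p norm_triangle_ineq[of "x i" w] w
      by (auto simp: g_def y_def single_def intro!: powr_mono2)
    have "f y = of_real (1 + t * z)"
    proof -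
      have "f y = f x + of_real t * (c * f (single i v))"
        unfolding y_def w_def single_s
        by (simp add: dual_add[OF f'(1) x_in_E E.scl_closed] dual_scl[OF f'(1)] single_in_E mult.assoc)
      then show ?thesis
        using c(2) f'(3) by (simp add: coord_def)
    qed
    then have "(1 + t * z) powr p = norm (f y) powr p"
      using t by (simp add: z_def del: of_real_add of_real_mult)
    also have "\<dots> \<le> nrm E y powr p"
      using p f'(2)[OF y] by (intro powr_mono2) auto
    also have "\<dots> = (\<Sum>j. norm (y j) powr p)"
      by (rule nrm_E_powr[OF y])
    also have "\<dots> \<le> (\<Sum>j. g j)"
      using le y sums_summable[OF g] by (intro suminf_le) (simp_all add: in_E)
    also have "\<dots> = 1 - norm (x i) powr p + (norm (x i) + t * norm v) powr p"
      using sums_unique[OF g] by simp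
    finally show "(1 + t * z) powr p \<le> 1 - norm (x i) powr p + (norm (x i) + t * norm v) powr p" .
  qed (simp_all add: z_def)
qed simp

text \<open>
  At \<open>x i\<close> the bound is attained, because the values of \<open>f\<close> at the coordinates of \<open>x\<close> and the bounds
  \<open>norm (x i) powr p\<close> on their norms have the same sum \<open>1\<close>.
\<close>

lemma coord_in_face:
  assumes f: "f \<in> S"
  shows "coord i f \<in> face i"
proof -
  have f': "f \<in> carrier (dual E)" "f x = 1"
    using f by (auto simp: S_iff)
  have le: "norm (coord j f (x j)) \<le> norm (x j) powr p" for j
    using norm_coord_le[OF f, of j "x j"] by (simp add: powr_pred_mult_norm)
  let ?r = "\<lambda>j. coord j f (x j) - (if j = i then coord i f (x i) else 0)"
  let ?g = "\<lambda>j. norm (x j) powr p - (if j = i then norm (x i) powr p else 0)"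
  have r: "?r sums (1 - coord i f (x i))"
    using coord_sums[OF f'(1) x_in_E] f'(2) by (auto intro!: sums_diff sums_single)
  have g: "?g sums (1 - norm (x i) powr p)"
    by (intro sums_diff x_sums sums_single)
  have "norm (suminf ?r) \<le> suminf ?g"
    by (rule norm_suminf_le) (use le sums_summable[OF g] in auto)
  then have "norm (1 - coord i f (x i)) \<le> 1 - norm (x i) powr p"
    using sums_unique[OF r] sums_unique[OF g] by simp
  then have "coord i f (x i) = of_real (norm (x i) powr p)"
    by (rule eq_of_real_if_norm_le[OF le])
  then show ?thesis
    using norm_coord_le[OF f] coord_in_dual[OF f'(1)] by (simp add: face_def)
qed

lemma combine_coord:
  assumes f: "f \<in> S"
  shows "combine (\<lambda>i. coord i f) = f"
proof
  fix y
  have f': "f \<in> carrier (dual E)"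
    using f by (simp add: S_iff)
  show "combine (\<lambda>i. coord i f) y = f y"
    using sums_unique[OF coord_sums[OF f']] dual_outside[OF f'] by (simp add: combine_def)
qed

lemma faceD:
  assumes "h \<in> PiE UNIV face"
  shows "h i \<in> carrier (dual X)" "norm (h i v) \<le> norm (x i) powr (p - 1) * norm v"
    "h i (x i) = of_real (norm (x i) powr p)"
proof -
  have "h i \<in> face i" using assms by auto
  then show "h i \<in> carrier (dual X)" "norm (h i v) \<le> norm (x i) powr (p - 1) * norm v"
    "h i (x i) = of_real (norm (x i) powr p)"
    by (simp_all add: face_def)
qed

lemma
  assumes h: "h \<in> PiE UNIV face"
  shows combine_in_S: "combine h \<in> S"
    and coord_combine: "coord i (combine h) = h i"
proof -
  have norm_sum: "summable (\<lambda>i. norm (x i) powr p)" "(\<Sum>i. norm (x i) powr p) \<le> 1 powr p"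
    using sums_unique[OF x_sums] sums_summable[OF x_sums] by simp_all
  note combine = combine_sums combine_in_dual norm_combine_le
  note combine_h = combine[of h "\<lambda>i. norm (x i)" 1, OF faceD(1,2)[OF h] norm_ge_zero norm_sum zero_less_one]
  have "(\<lambda>i. h i (x i)) sums of_real 1"
    using sums_of_real[OF x_sums] by (simp add: faceD(3)[OF h])
  then have "combine h x = 1"
    using sums_unique2[OF combine_h(1)[OF x_in_E]] by simp
  then show "combine h \<in> S"
    using combine_h(2,3) by (simp add: S_iff)
  show "coord i (combine h) = h i"
  proof
    fix v
    have "(\<lambda>j. h j (single i v j)) = (\<lambda>j. if j = i then h i v else 0)"
      using X.dual_zero[OF faceD(1)[OF h]] by (auto simp: single_def)
    then show "coord i (combine h) v = h i v"
      unfolding coord_def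
      using sums_unique2[OF combine_h(1)[OF single_in_E, of i v]] sums_single[of i "\<lambda>_. h i v"] by simp
  qed
qed

lemma S_eq_combine: "S = combine ` PiE UNIV face"
proof (intro subset_antisym subsetI)
  fix f assume f: "f \<in> S"
  then have "(\<lambda>i. coord i f) \<in> PiE UNIV face"
    by (simp add: coord_in_face PiE_UNIV_domain)
  then show "f \<in> combine ` PiE UNIV face"
    using combine_coord[OF f] by (metis image_eqI)
qed (use combine_in_S in blast)

section \<open>Weak compactness\<close>

text \<open>
  \<open>combine (drop_coords n h)\<close> is what remains of \<open>combine h\<close> after its first \<open>n\<close> summands. Only the
  tail of \<open>x\<close> enters the bound on it, so that it tends to \<open>0\<close> in norm uniformly on the product of the faces.
\<close>

definition drop_coords :: "nat \<Rightarrow> (nat \<Rightarrow> 'a \<Rightarrow> 'k) \<Rightarrow> nat \<Rightarrow> 'a \<Rightarrow> 'k" where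
  "drop_coords n h = (\<lambda>i. if i < n then 0 else h i)"

lemma drop_coords_bound:
  assumes h: "h \<in> PiE UNIV face"
  shows "drop_coords n h i \<in> carrier (dual X)"
    and "norm (drop_coords n h i v) \<le> norm (tail n x i) powr (p - 1) * norm v"
  using faceD[OF h] by (auto simp: drop_coords_def tail_def zero_in_dual)

lemma
  assumes h: "h \<in> PiE UNIV face"
  shows combine_drop_coords_in_dual: "combine (drop_coords n h) \<in> carrier (dual E)"
    and combine_drop_coords_sums:
      "y \<in> carrier E \<Longrightarrow> (\<lambda>i. drop_coords n h i (y i)) sums combine (drop_coords n h) y"
proof -
  have t: "(\<lambda>j. norm (tail n x j) powr p) sums (1 - (\<Sum>j<n. norm (x j) powr p))"
    using tail_sums[OF x_in_E, of n] sums_unique[OF x_sums] by simp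
  have "0 \<le> (\<Sum>j<n. norm (x j) powr p)"
    by (intro sum_nonneg) auto
  then have le: "(\<Sum>j. norm (tail n x j) powr p) \<le> 1 powr p"
    using sums_unique[OF t] by simp
  note bounds = drop_coords_bound[OF h] norm_ge_zero sums_summable[OF t] le zero_less_one
  show "combine (drop_coords n h) \<in> carrier (dual E)"
    by (rule combine_in_dual[OF bounds])
  show "y \<in> carrier E \<Longrightarrow> (\<lambda>i. drop_coords n h i (y i)) sums combine (drop_coords n h) y"
    by (rule combine_sums[OF bounds])
qed

lemma nrm_combine_drop_coords_le:
  assumes h: "h \<in> PiE UNIV face" and B: "nrm E (tail n x) \<le> B" "0 < B"
  shows "nrm (dual E) (combine (drop_coords n h)) \<le> B powr (p - 1)"
proof (rule E.nrm_dual_le)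
  have t: "tail n x \<in> carrier E"
    by (rule tail_in_E[OF x_in_E])
  have le: "(\<Sum>j. norm (tail n x j) powr p) \<le> B powr p"
    unfolding nrm_E_powr[OF t, symmetric] using B p E.nrm_nonneg[OF t] by (intro powr_mono2) auto
  fix y assume "y \<in> carrier E"
  with t le B(2) drop_coords_bound[OF h] show
    "norm (combine (drop_coords n h) y) \<le> B powr (p - 1) * nrm E y"
    by (intro norm_combine_le[where b = "\<lambda>i. norm (tail n x i)"]) (auto simp: in_E)
qed simp

lemma functional_combine_eq:
  assumes F: "F \<in> carrier (dual (dual E))" and h: "h \<in> PiE UNIV face"
  shows "F (combine h) = (\<Sum>i<n. F (embed i (h i))) + F (combine (drop_coords n h))"
proof (induction n)
  case 0
  then show ?case by (simp add: drop_coords_def)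
next
  case (Suc n)
  have "combine (drop_coords n h) = embed n (h n) + combine (drop_coords (Suc n) h)"
  proof
    fix y
    show "combine (drop_coords n h) y = (embed n (h n) + combine (drop_coords (Suc n) h)) y"
    proof (cases "y \<in> carrier E")
      case True
      have "(\<lambda>i. drop_coords n h i (y i)) =
          (\<lambda>i. (if i = n then h i (y i) else 0) + drop_coords (Suc n) h i (y i))"
        by (auto simp: drop_coords_def less_Suc_eq)
      then have "(\<lambda>i. drop_coords n h i (y i)) sums (h n (y n) + combine (drop_coords (Suc n) h) y)"
        using sums_add[OF sums_single combine_drop_coords_sums[OF h True], of n "\<lambda>i. h i (y i)"] by simp
      then show ?thesis
        using sums_unique2[OF combine_drop_coords_sums[OF h True]] True by (simp add: embed_def)
    qed (simp add: combine_def embed_def)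
  qed
  then have "F (combine (drop_coords n h)) = F (embed n (h n)) + F (combine (drop_coords (Suc n) h))"
    using dual_add[OF F embed_in_dual[OF faceD(1)[OF h]] combine_drop_coords_in_dual[OF h]] by simp
  with Suc show ?case by simp
qed

text \<open>
  A functional on the dual applied to \<open>combine h\<close> is a uniform limit of finite sums of terms that
  depend weakly continuously on a single coordinate of \<open>h\<close>.
\<close>

lemma continuous_map_combine:
  "continuous_map
     (subtopology (product_topology (\<lambda>_. weak_topology (dual X)) UNIV) (PiE UNIV face))
     (weak_topology (dual E)) combine"
    (is "continuous_map ?P _ _")
proof (rule continuous_map_into_weak_topology)
  have P: "h \<in> PiE UNIV face" if "h \<in> topspace ?P" for h
    using that by simp
  then show "combine ` topspace ?P \<subseteq> carrier (dual E)"
    using combine_in_S S_iff by blast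
  fix F assume F: "F \<in> carrier (dual (dual E))"
  obtain K where K: "\<And>f. f \<in> carrier (dual E) \<Longrightarrow> norm (F f) \<le> K * nrm (dual E) f"
    using dual_bounded[OF F] by blast
  have "continuous_map ?P Met_TC.mtopology (\<lambda>h. F (combine h))"
  proof (rule Met_TC.continuous_map_uniform_limit[where F = sequentially
        and f = "\<lambda>n h. \<Sum>i<n. F (embed i (h i))"])
    have "continuous_map ?P euclidean (\<lambda>h. F (embed i (h i)))" for i
    proof -
      let ?G = "\<lambda>g. if g \<in> carrier (dual X) then F (embed i g) else 0"
      have "?G \<in> carrier (dual (dual X))"
      proof (rule pullback_in_bidual[where B = 1, OF F])
        show "embed i (f + g) = embed i f + embed i g" for f g
          by (auto simp: embed_def fun_eq_iff)
        show "embed i (scl (dual X) c f) = scl (dual E) c (embed i f)" for c f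
          by (auto simp: embed_def scl_dual)
      qed (simp_all add: embed_in_dual nrm_embed_le E.nrm_dual_nonneg)
      then have "continuous_map ?P euclidean (?G \<circ> (\<lambda>h. h i))"
        by (intro continuous_map_compose[of _ "weak_topology (dual X)"] continuous_map_functional
            continuous_map_from_subtopology continuous_map_product_projection) auto
      then show ?thesis
        by (rule continuous_map_eq) (use faceD(1)[OF P] in simp)
    qed
    then show "\<forall>\<^sub>F n in sequentially.
        continuous_map ?P Met_TC.mtopology (\<lambda>h. \<Sum>i<n. F (embed i (h i)))"
      by (intro always_eventually allI) (auto intro!: continuous_map_sum)
  next
    fix \<delta> :: real assume \<delta>: "0 < \<delta>"
    \<comment> \<open>The choice makes \<open>B powr (p - 1)\<close> equal to \<open>\<delta> / (\<bar>K\<bar> + 1)\<close>.\<close>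
    define B where "B = (\<delta> / (\<bar>K\<bar> + 1)) powr (1 / (p - 1))"
    have B: "0 < B" "B powr (p - 1) = \<delta> / (\<bar>K\<bar> + 1)"
      using \<delta> p by (simp_all add: B_def powr_powr)
    have "\<forall>\<^sub>F n in sequentially. nrm E (tail n x) < B"
      using nrm_tail_tendsto_0[OF x_in_E] B(1) by (rule order_tendstoD)
    then show "\<forall>\<^sub>F n in sequentially. \<forall>h\<in>topspace ?P. F (combine h) \<in> UNIV \<and>
        dist (\<Sum>i<n. F (embed i (h i))) (F (combine h)) < \<delta>"
    proof eventually_elim
      case (elim n)
      have "dist (\<Sum>i<n. F (embed i (h i))) (F (combine h)) < \<delta>" if "h \<in> topspace ?P" for h
      proof -
        note h = P[OF that]
        let ?r = "combine (drop_coords n h)"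
        have r: "?r \<in> carrier (dual E)"
          by (rule combine_drop_coords_in_dual[OF h])
        have "dist (\<Sum>i<n. F (embed i (h i))) (F (combine h)) = norm (F ?r)"
          by (simp add: functional_combine_eq[OF F h, of n] dist_norm)
        also have "\<dots> \<le> \<bar>K\<bar> * nrm (dual E) ?r"
          using K[OF r] mult_right_mono[OF abs_ge_self[of K] E.nrm_dual_nonneg[OF r]] by linarith
        also have "\<dots> \<le> \<bar>K\<bar> * (\<delta> / (\<bar>K\<bar> + 1))"
          using nrm_combine_drop_coords_le[OF h _ B(1)] elim by (intro mult_left_mono) (auto simp: B(2))
        also have "\<dots> < \<delta>"
          using \<delta> by (simp add: field_simps)
        finally show ?thesis .
      qed
      then show ?case by simp
    qed
  qed simp
  then show "continuous_map ?P euclidean (\<lambda>h. F (combine h))"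
    by simp
qed

lemma face_eq_scl:
  assumes "x i \<noteq> 0"
  defines "c \<equiv> of_real (norm (x i) powr (p - 1))"
  shows "face i = scl (dual X) c ` state_space X (x i /\<^sub>R norm (x i))"
    and "state_space X (x i /\<^sub>R norm (x i)) = scl (dual X) (1 / c) ` face i"
proof -
  let ?u = "x i /\<^sub>R norm (x i)"
  have c: "c \<noteq> 0" and norm_c: "norm c = norm (x i) powr (p - 1)"
    using assms(1) by (simp_all add: c_def)
  have u: "?u \<in> unit_sphere X"
    using assms(1) by (simp add: unit_sphere_def X_simps)
  have u_eq: "?u = s (of_real (1 / norm (x i))) (x i)"
  proof -
    have "s (of_real r) v = r *\<^sub>R v" for r v
      using s by (simp add: banach_scaling_def)
    then show ?thesis by (simp only: inverse_eq_divide)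
  qed
  have c_mult: "c * of_real (norm (x i)) = of_real (norm (x i) powr p)"
    unfolding c_def by (simp only: of_real_mult[symmetric] powr_pred_mult_norm)
  have at_u: "g ?u = 1 \<longleftrightarrow> c * g (x i) = of_real (norm (x i) powr p)"
    if "g \<in> carrier (dual X)" for g
  proof -
    have nonzero: "(of_real (norm (x i)) :: 'k) \<noteq> 0"
      using assms(1) by simp
    have u_value: "g ?u = of_real (1 / norm (x i)) * g (x i)"
      unfolding u_eq using dual_scl[OF that, of "x i"] by (simp add: X_simps)
    have "of_real (1 / norm (x i)) * b = 1 \<longleftrightarrow> b = of_real (norm (x i))" for b :: 'k
      using nonzero by (simp add: divide_eq_eq)
    then have "g ?u = 1 \<longleftrightarrow> g (x i) = of_real (norm (x i))"
      by (simp only: u_value)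
    also have "\<dots> \<longleftrightarrow> c * g (x i) = c * of_real (norm (x i))"
      using c by simp
    finally show ?thesis by (simp only: c_mult)
  qed
  have in_dual: "scl (dual X) c g \<in> carrier (dual X) \<longleftrightarrow> g \<in> carrier (dual X)" for g
  proof
    assume "scl (dual X) c g \<in> carrier (dual X)"
    then have "scl (dual X) (1 / c) (scl (dual X) c g) \<in> carrier (dual X)"
      by (rule scl_in_dual)
    then show "g \<in> carrier (dual X)"
      using c by (simp add: scl_dual)
  qed (rule scl_in_dual)
  have iff: "scl (dual X) c g \<in> face i \<longleftrightarrow> g \<in> state_space X ?u" for g
  proof -
    have bound: "(\<forall>v. norm (c * g v) \<le> norm (x i) powr (p - 1) * norm v) \<longleftrightarrow> (\<forall>v. norm (g v) \<le> norm v)"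
      using assms(1) by (simp add: norm_mult norm_c)
    show ?thesis
      unfolding X.state_space_iff[OF u] face_def mem_Collect_eq in_dual
      using at_u[of g] bound by (simp add: scl_dual X_simps cong: conj_cong)
  qed
  have inverse: "scl (dual X) c (scl (dual X) (1 / c) g) = g"
    "scl (dual X) (1 / c) (scl (dual X) c g) = g" for g
    using c by (simp_all add: scl_dual)
  have sub: "scl (dual X) c ` state_space X ?u \<subseteq> face i"
    "scl (dual X) (1 / c) ` face i \<subseteq> state_space X ?u"
    using iff by (auto simp: iff[symmetric] inverse)
  show "face i = scl (dual X) c ` state_space X ?u"
  proof (intro subset_antisym sub(1) subsetI)
    fix h assume "h \<in> face i"
    then have "scl (dual X) (1 / c) h \<in> state_space X ?u"
      using sub(2) by blast
    then show "h \<in> scl (dual X) c ` state_space X ?u"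
      by (rule rev_image_eqI) (rule inverse(1)[symmetric])
  qed
  show "state_space X ?u = scl (dual X) (1 / c) ` face i"
  proof (intro subset_antisym sub(2) subsetI)
    fix g assume "g \<in> state_space X ?u"
    then have "scl (dual X) c g \<in> face i"
      using sub(1) by blast
    then show "g \<in> scl (dual X) (1 / c) ` face i"
      by (rule rev_image_eqI) (rule inverse(2)[symmetric])
  qed
qed

lemma face_nonempty: "face i \<noteq> {}"
proof -
  obtain h where h: "h \<in> carrier (dual X)" "\<And>w. norm (h w) \<le> norm w" "h (x i) = of_real (norm (x i))"
    using norming[of "x i"] by blast
  have "scl (dual X) (of_real (norm (x i) powr (p - 1))) h \<in> face i"
    using scl_in_dual[OF h(1)] h(2,3) powr_pred_mult_norm[of "x i"]
    by (auto simp: face_def scl_dual norm_mult of_real_mult[symmetric] intro!: mult_left_mono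
        simp del: of_real_mult)
  then show ?thesis by blast
qed

lemma weakly_compact_face_iff:
  assumes "x i \<noteq> 0"
  shows "weakly_compact (dual X) (face i) \<longleftrightarrow>
    weakly_compact (dual X) (state_space X (x i /\<^sub>R norm (x i)))"
  unfolding weakly_compact_def
  using face_eq_scl[OF assms] image_compactin[OF _ X.continuous_map_weak_scl] by metis

lemma weakly_compact_face_zero:
  assumes "x i = 0"
  shows "weakly_compact (dual X) (face i)"
proof -
  have "face i = {0}"
    using assms p by (auto simp: face_def zero_in_dual fun_eq_iff)
  then show ?thesis
    using zero_in_dual by (simp add: weakly_compact_def topspace_weak_topology)
qed

text \<open>
  Since no face is empty, every face is the full image of the state space under its coordinate map.
\<close>

theorem weakly_compact_state_space_iff:
  "weakly_compact (dual E) S \<longleftrightarrow>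
     (\<forall>i. x i \<noteq> 0 \<longrightarrow> weakly_compact (dual X) (state_space X (x i /\<^sub>R norm (x i))))"
proof
  assume S: "weakly_compact (dual E) S"
  have "face i = coord i ` S" for i
  proof (intro subset_antisym subsetI)
    fix g assume g: "g \<in> face i"
    define h where "h = (\<lambda>j. SOME g'. g' \<in> face j)(i := g)"
    have "h \<in> PiE UNIV face"
      using g face_nonempty by (auto simp: h_def some_in_eq)
    then have "combine h \<in> S" "coord i (combine h) = g"
      using combine_in_S coord_combine by (auto simp: h_def)
    then show "g \<in> coord i ` S" by blast
  qed (use coord_in_face in blast)
  then have "weakly_compact (dual X) (face i)" for i
    using S image_compactin[OF _ continuous_map_coord] by (simp add: weakly_compact_def)
  then show "\<forall>i. x i \<noteq> 0 \<longrightarrow> weakly_compact (dual X) (state_space X (x i /\<^sub>R norm (x i)))"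
    using weakly_compact_face_iff by blast
next
  assume "\<forall>i. x i \<noteq> 0 \<longrightarrow> weakly_compact (dual X) (state_space X (x i /\<^sub>R norm (x i)))"
  then have "compactin (weak_topology (dual X)) (face i)" for i
    using weakly_compact_face_iff weakly_compact_face_zero unfolding weakly_compact_def by blast
  then have "compactin (product_topology (\<lambda>_. weak_topology (dual X)) UNIV) (PiE UNIV face)"
    by (simp add: compactin_PiE)
  then show "weakly_compact (dual E) S"
    unfolding weakly_compact_def S_eq_combine
    by (intro image_compactin[OF _ continuous_map_combine]) (simp add: compactin_subtopology)
qed

end

section \<open>Real and complex scalars\<close>

theorem corollary2p7:
  fixes p :: real
  assumes "1 < p"
  shows
    "(\<forall>x :: nat \<Rightarrow> 'a::banach.
        let X = whole_space (scaleR :: real \<Rightarrow> 'a \<Rightarrow> 'a)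
        in x \<in> unit_sphere (lp_space p X) \<longrightarrow>
           (weakly_compact (dual (lp_space p X)) (state_space (lp_space p X) x) \<longleftrightarrow>
            (\<forall>i. x i \<noteq> 0 \<longrightarrow> weakly_compact (dual X) (state_space X (x i /\<^sub>R norm (x i)))))) \<and>
     (\<forall>(s :: complex \<Rightarrow> 'b::banach \<Rightarrow> 'b) (x :: nat \<Rightarrow> 'b).
        let X = whole_space s
        in banach_scaling s \<longrightarrow> x \<in> unit_sphere (lp_space p X) \<longrightarrow>
           (weakly_compact (dual (lp_space p X)) (state_space (lp_space p X) x) \<longleftrightarrow>
            (\<forall>i. x i \<noteq> 0 \<longrightarrow> weakly_compact (dual X) (state_space X (x i /\<^sub>R norm (x i))))))"
  unfolding Let_def
proof (intro conjI allI impI)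
  fix x :: "nat \<Rightarrow> 'a"
  let ?X = "whole_space (scaleR :: real \<Rightarrow> 'a \<Rightarrow> 'a)"
  assume x: "x \<in> unit_sphere (lp_space p ?X)"
  interpret lp_state p "scaleR :: real \<Rightarrow> 'a \<Rightarrow> 'a" x
  proof unfold_locales
    show "banach_scaling (scaleR :: real \<Rightarrow> 'a \<Rightarrow> 'a)"
      by (auto simp: banach_scaling_def real_vector.vector_space_axioms)
    fix v :: 'a
    obtain f :: "'a \<Rightarrow> real" where f: "linear f" "\<And>v. \<bar>f v\<bar> \<le> norm v" "f v = norm v"
      using real_norming_functional[of v] by blast
    have "\<forall>v. norm (f v) \<le> 1 * norm v"
      using f(2) by simp
    then have "\<exists>K. \<forall>v. norm (f v) \<le> K * norm v" ..
    then have "f \<in> carrier (dual ?X)"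
      unfolding in_dual_iff using f(1) by (simp add: whole_space_def linear_add linear_cmul)
    with f show "\<exists>h\<in>carrier (dual ?X). (\<forall>w. norm (h w) \<le> norm w) \<and> h v = of_real (norm v)"
      by auto
  qed (rule assms x)+
  show "weakly_compact (dual (lp_space p ?X)) (state_space (lp_space p ?X) x) \<longleftrightarrow>
      (\<forall>i. x i \<noteq> 0 \<longrightarrow> weakly_compact (dual ?X) (state_space ?X (x i /\<^sub>R norm (x i))))"
    by (rule weakly_compact_state_space_iff)
next
  fix s :: "complex \<Rightarrow> 'b \<Rightarrow> 'b" and x :: "nat \<Rightarrow> 'b"
  assume s: "banach_scaling s" and x: "x \<in> unit_sphere (lp_space p (whole_space s))"
  interpret lp_state p s x
  proof unfold_locales
    fix v :: 'b
    obtain f :: "'b \<Rightarrow> complex" where f: "\<And>v w. f (v + w) = f v + f w" "\<And>c v. f (s c v) = c * f v"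
      "\<And>v. norm (f v) \<le> norm v" "f v = of_real (norm v)"
      using complex_norming_functional[OF s, of v] by blast
    have "\<forall>v. norm (f v) \<le> 1 * norm v"
      using f(3) by simp
    then have "\<exists>K. \<forall>v. norm (f v) \<le> K * norm v" ..
    then have "f \<in> carrier (dual (whole_space s))"
      unfolding in_dual_iff using f by (simp add: whole_space_def)
    with f show "\<exists>h\<in>carrier (dual (whole_space s)).
        (\<forall>w. norm (h w) \<le> norm w) \<and> h v = of_real (norm v)"
      by auto
  qed (rule assms s x)+
  show "weakly_compact (dual (lp_space p (whole_space s))) (state_space (lp_space p (whole_space s)) x)
      \<longleftrightarrow> (\<forall>i. x i \<noteq> 0 \<longrightarrow>
        weakly_compact (dual (whole_space s)) (state_space (whole_space s) (x i /\<^sub>R norm (x i))))"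
    by (rule weakly_compact_state_space_iff)
qed

end
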